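(* The three elements of the Racah algebra $\Re$ $$\Omega_A = D^2+\frac{BAC+CAB}{2}+A^2+B\gamma-C\beta-A\delta,$$ $$\Omega_B = D^2+\frac{CBA+ABC}{2}+B^2+C\alpha-A\gamma-B\delta,$$ $$\Omega_C = D^2+\frac{ACB+BCA}{2}+C^2+A\beta-B\alpha-C\delta$$ (called the $D_6$-symmetric Casimir elements of $\Re$) are mutually distinct.
   Context: $\mathbb F$ is a field with $\operatorname{char}\mathbb F\neq 2$. All algebras are unital and associative. Write $[x,y]=xy-yx$. The Racah algebra $\Re$ is the $\mathbb F$-algebra defined by generators $A,B,C,D$ and the relations $[A,B]=[B,C]=[C,A]=2D$ together with the relations asserting that each of the elements $$\alpha=[A,D]+AC-BA,\qquad \beta=[B,D]+BA-CB,\qquad \gamma=[C,D]+CB-AC$$ is central in $\Re$. Set $\delta=A+B+C$. *)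

theory Defs
  imports Complex_Main "HOL-Library.Poly_Mapping"
begin

section \<open>The free associative algebra on four generators\<close>

datatype generator = Gen_A | Gen_B | Gen_C | Gen_D

text \<open>
  A wrapper around lists, so that concatenation can be made the (noncommutative) monoid operation
  that underlies the convolution product on \<open>\<Rightarrow>\<^sub>0\<close>.  As that product is driven by the class
  \<open>monoid_add\<close>, the empty word is \<open>0\<close> and concatenation is \<open>+\<close>.
\<close>

datatype gword = Word (letters: "generator list")

instantiation gword :: monoid_add
begin

definition zero_gword :: gword where
  "0 = Word []"

definition plus_gword :: "gword \<Rightarrow> gword \<Rightarrow> gword" where
  "u + v = Word (letters u @ letters v)"

instance
  by standard (simp_all add: zero_gword_def plus_gword_def)

end

lemma gword_add_eq_0_iff: "0 = u + v \<longleftrightarrow> u = 0 \<and> v = (0 :: gword)"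
  by (cases u; cases v) (auto simp: zero_gword_def plus_gword_def)

type_synonym 'f free_alg = "gword \<Rightarrow>\<^sub>0 'f"

definition free_gen :: "generator \<Rightarrow> 'f::field free_alg" where
  "free_gen g = Poly_Mapping.single (Word [g]) 1"

lemma lookup_mult_0:
  fixes p q :: "'f::field free_alg"
  shows "Poly_Mapping.lookup (p * q) 0 = Poly_Mapping.lookup p 0 * Poly_Mapping.lookup q 0"
proof -
  have "(\<Sum>v. Poly_Mapping.lookup q v when 0 = u + v) = (Poly_Mapping.lookup q 0 when u = 0)" for u
    by (cases "u = 0") (simp_all add: gword_add_eq_0_iff)
  then show ?thesis
    by (simp add: lookup_mult mult_when)
qed

section \<open>Presentations: two-sided ideals\<close>

inductive_set two_sided_ideal :: "'a::ring_1 set \<Rightarrow> 'a set" for S where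
  zero: "0 \<in> two_sided_ideal S"
| gen: "s \<in> S \<Longrightarrow> a * s * b \<in> two_sided_ideal S"
| add: "x \<in> two_sided_ideal S \<Longrightarrow> y \<in> two_sided_ideal S \<Longrightarrow> x + y \<in> two_sided_ideal S"

lemma two_sided_ideal_base: "s \<in> S \<Longrightarrow> s \<in> two_sided_ideal S"
  using two_sided_ideal.gen[of s S 1 1] by simp

lemma two_sided_ideal_mult_left: "x \<in> two_sided_ideal S \<Longrightarrow> c * x \<in> two_sided_ideal S"
proof (induction rule: two_sided_ideal.induct)
  case (gen s a b)
  then show ?case
    using two_sided_ideal.gen[of s S "c * a" b] by (simp add: mult.assoc)
qed (simp_all add: distrib_left two_sided_ideal.intros)

lemma two_sided_ideal_mult_right: "x \<in> two_sided_ideal S \<Longrightarrow> x * c \<in> two_sided_ideal S"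
proof (induction rule: two_sided_ideal.induct)
  case (gen s a b)
  then show ?case
    using two_sided_ideal.gen[of s S a "b * c"] by (simp add: mult.assoc)
qed (simp_all add: distrib_right two_sided_ideal.intros)

lemma two_sided_ideal_uminus: "x \<in> two_sided_ideal S \<Longrightarrow> - x \<in> two_sided_ideal S"
  using two_sided_ideal_mult_left[of x S "-1"] by simp

lemma two_sided_ideal_diff:
  "x \<in> two_sided_ideal S \<Longrightarrow> y \<in> two_sided_ideal S \<Longrightarrow> x - y \<in> two_sided_ideal S"
  using two_sided_ideal.add[of x S "- y"] two_sided_ideal_uminus[of y S] by simp

section \<open>The Racah algebra\<close>

definition commutator :: "'a::ring \<Rightarrow> 'a \<Rightarrow> 'a" where
  "commutator x y = x * y - y * x"

text \<open>
  The following three expressions are used both in the free algebra, to state the defining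
  relations, and in the quotient.
\<close>

definition alpha_expr :: "'a::ring \<Rightarrow> 'a \<Rightarrow> 'a \<Rightarrow> 'a \<Rightarrow> 'a" where
  "alpha_expr A B C D = commutator A D + A * C - B * A"

definition beta_expr :: "'a::ring \<Rightarrow> 'a \<Rightarrow> 'a \<Rightarrow> 'a \<Rightarrow> 'a" where
  "beta_expr A B C D = commutator B D + B * A - C * B"

definition gamma_expr :: "'a::ring \<Rightarrow> 'a \<Rightarrow> 'a \<Rightarrow> 'a \<Rightarrow> 'a" where
  "gamma_expr A B C D = commutator C D + C * B - A * C"

definition racah_relators :: "'f::field free_alg set" where
  "racah_relators =
    (let A = free_gen Gen_A; B = free_gen Gen_B; C = free_gen Gen_C; D = free_gen Gen_D in
      {commutator A B - 2 * D, commutator B C - 2 * D, commutator C A - 2 * D} \<union>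
      (\<Union>x. {commutator (alpha_expr A B C D) x,
             commutator (beta_expr A B C D) x,
             commutator (gamma_expr A B C D) x}))"

definition racah_rel :: "'f::field free_alg \<Rightarrow> 'f free_alg \<Rightarrow> bool" where
  "racah_rel p q \<longleftrightarrow> p - q \<in> two_sided_ideal racah_relators"

lemma equivp_racah_rel: "equivp racah_rel"
proof (rule equivpI)
  show "reflp racah_rel"
    by (simp add: reflp_def racah_rel_def two_sided_ideal.zero)
  show "symp racah_rel"
    unfolding symp_def racah_rel_def
    by (metis minus_diff_eq two_sided_ideal_uminus)
  show "transp racah_rel"
    unfolding transp_def racah_rel_def
    using two_sided_ideal.add by fastforce
qed

lemma lookup_commutator_0:
  "Poly_Mapping.lookup (commutator p q) 0 = 0" for p q :: "'f::field free_alg"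
  by (simp add: commutator_def lookup_minus lookup_mult_0)

lemma lookup_free_gen_0: "Poly_Mapping.lookup (free_gen g) 0 = 0"
  by (simp add: free_gen_def lookup_single zero_gword_def)

lemma two_sided_ideal_relators_lookup_0:
  "p \<in> two_sided_ideal racah_relators \<Longrightarrow> Poly_Mapping.lookup p 0 = 0"
proof (induction rule: two_sided_ideal.induct)
  case (gen s a b)
  then have "Poly_Mapping.lookup s 0 = 0"
    by (auto simp: racah_relators_def Let_def lookup_commutator_0 lookup_minus lookup_mult_0
        lookup_free_gen_0)
  then show ?case by (simp add: lookup_mult_0)
qed (simp_all add: lookup_add)

quotient_type (overloaded) 'f racah = "'f::field free_alg" / racah_rel
  by (rule equivp_racah_rel)

instantiation racah :: (field) ring_1
begin

lift_definition zero_racah :: "'a racah" is 0 .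

lift_definition one_racah :: "'a racah" is 1 .

lift_definition plus_racah :: "'a racah \<Rightarrow> 'a racah \<Rightarrow> 'a racah" is "(+)"
proof -
  fix p p' q q' :: "'a free_alg"
  assume "racah_rel p p'" "racah_rel q q'"
  then have "(p - p') + (q - q') \<in> two_sided_ideal racah_relators"
    unfolding racah_rel_def by (rule two_sided_ideal.add)
  then show "racah_rel (p + q) (p' + q')"
    by (simp add: racah_rel_def algebra_simps)
qed

lift_definition minus_racah :: "'a racah \<Rightarrow> 'a racah \<Rightarrow> 'a racah" is "(-)"
proof -
  fix p p' q q' :: "'a free_alg"
  assume "racah_rel p p'" "racah_rel q q'"
  then have "(p - p') - (q - q') \<in> two_sided_ideal racah_relators"
    unfolding racah_rel_def by (rule two_sided_ideal_diff)
  then show "racah_rel (p - q) (p' - q')"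
    by (simp add: racah_rel_def algebra_simps)
qed

lift_definition uminus_racah :: "'a racah \<Rightarrow> 'a racah" is uminus
proof -
  fix p p' :: "'a free_alg"
  assume "racah_rel p p'"
  then have "- (p - p') \<in> two_sided_ideal racah_relators"
    unfolding racah_rel_def by (rule two_sided_ideal_uminus)
  then show "racah_rel (- p) (- p')"
    by (simp add: racah_rel_def)
qed

lift_definition times_racah :: "'a racah \<Rightarrow> 'a racah \<Rightarrow> 'a racah" is "(*)"
proof -
  fix p p' q q' :: "'a free_alg"
  assume "racah_rel p p'" "racah_rel q q'"
  then have "p * (q - q') + (p - p') * q' \<in> two_sided_ideal racah_relators"
    unfolding racah_rel_def
    by (intro two_sided_ideal.add two_sided_ideal_mult_left two_sided_ideal_mult_right)
  then show "racah_rel (p * q) (p' * q')"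
    by (simp add: racah_rel_def algebra_simps)
qed

instance
proof
  show "(0 :: 'a racah) \<noteq> 1"
    by transfer (auto simp: racah_rel_def lookup_minus dest!: two_sided_ideal_relators_lookup_0)
qed (transfer; simp add: racah_rel_def algebra_simps two_sided_ideal.zero)+

end

text \<open>The \<open>'f\<close>-algebra structure.\<close>

lift_definition racah_scale :: "'f::field \<Rightarrow> 'f racah \<Rightarrow> 'f racah"  (infixr "*\<^sub>F" 75)
  is "\<lambda>c p. Poly_Mapping.single 0 c * p"
  unfolding racah_rel_def by (metis right_diff_distrib two_sided_ideal_mult_left)

lift_definition racah_A :: "'f::field racah" is "free_gen Gen_A" .
lift_definition racah_B :: "'f::field racah" is "free_gen Gen_B" .
lift_definition racah_C :: "'f::field racah" is "free_gen Gen_C" .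
lift_definition racah_D :: "'f::field racah" is "free_gen Gen_D" .

definition racah_alpha :: "'f::field racah" where
  "racah_alpha = alpha_expr racah_A racah_B racah_C racah_D"

definition racah_beta :: "'f::field racah" where
  "racah_beta = beta_expr racah_A racah_B racah_C racah_D"

definition racah_gamma :: "'f::field racah" where
  "racah_gamma = gamma_expr racah_A racah_B racah_C racah_D"

definition racah_delta :: "'f::field racah" where
  "racah_delta = racah_A + racah_B + racah_C"

definition Omega_A :: "'f::field racah" where
  "Omega_A = racah_D ^ 2 + (1 / 2) *\<^sub>F (racah_B * racah_A * racah_C + racah_C * racah_A * racah_B)
     + racah_A ^ 2 + racah_B * racah_gamma - racah_C * racah_beta - racah_A * racah_delta"

definition Omega_B :: "'f::field racah" where
  "Omega_B = racah_D ^ 2 + (1 / 2) *\<^sub>F (racah_C * racah_B * racah_A + racah_A * racah_B * racah_C)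
     + racah_B ^ 2 + racah_C * racah_alpha - racah_A * racah_gamma - racah_B * racah_delta"

definition Omega_C :: "'f::field racah" where
  "Omega_C = racah_D ^ 2 + (1 / 2) *\<^sub>F (racah_A * racah_C * racah_B + racah_B * racah_C * racah_A)
     + racah_C ^ 2 + racah_A * racah_beta - racah_B * racah_alpha - racah_C * racah_delta"

section \<open>Basic properties of the presentation\<close>

lemma single_0_mult_commute:
  fixes p :: "'f::field free_alg"
  shows "Poly_Mapping.single 0 c * p = p * Poly_Mapping.single 0 c"
proof (induction p rule: Poly_Mapping.update_induct)
  case (update p a b)
  have "Poly_Mapping.update a b p = p + Poly_Mapping.single a b"
    using update.hyps(1)
    by (intro poly_mapping_eqI)
      (auto simp: lookup_update lookup_add lookup_single when_def in_keys_iff)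
  with update.IH show ?case
    by (simp add: distrib_left distrib_right mult_single mult.commute)
qed simp

lemma vector_space_racah_scale: "vector_space (racah_scale :: 'f::field \<Rightarrow> 'f racah \<Rightarrow> 'f racah)"
  by (rule vector_space.intro; transfer)
    (simp_all add: racah_rel_def two_sided_ideal.zero mult_single single_add algebra_simps
      flip: mult.assoc)

lemma racah_scale_mult_left: "(c *\<^sub>F x) * y = c *\<^sub>F (x * y)"
  by transfer (simp add: racah_rel_def two_sided_ideal.zero mult.assoc)

lemma racah_scale_mult_right: "x * (c *\<^sub>F y) = c *\<^sub>F (x * y)"
proof (transfer, goal_cases)
  case (1 x c y)
  have "x * (Poly_Mapping.single 0 c * y) = Poly_Mapping.single 0 c * (x * y)"
    by (metis single_0_mult_commute mult.assoc)
  then show ?case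
    by (simp add: racah_rel_def two_sided_ideal.zero)
qed

lemma racah_commutators:
  "commutator racah_A racah_B = 2 * (racah_D :: 'f::field racah)"
  "commutator racah_B racah_C = 2 * (racah_D :: 'f racah)"
  "commutator racah_C racah_A = 2 * (racah_D :: 'f racah)"
  unfolding commutator_def mult_2
  by (transfer; simp add: racah_rel_def;
      rule two_sided_ideal_base; simp add: racah_relators_def commutator_def mult_2 Let_def)+

lemma racah_central:
  "racah_alpha * x = x * racah_alpha"
  "racah_beta * x = x * racah_beta"
  "racah_gamma * x = x * racah_gamma"
  unfolding racah_alpha_def alpha_expr_def racah_beta_def beta_expr_def racah_gamma_def
    gamma_expr_def commutator_def
  by (transfer; unfold racah_rel_def; rule two_sided_ideal_base;
      auto simp: racah_relators_def alpha_expr_def beta_expr_def gamma_expr_def commutator_def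
        Let_def)+

end

(* The commutative quotient of the Racah algebra imposes only D = 0, so every choice of scalars
   a, b, c for A, B, C gives a character. It sends Omega_A to bc(b + c - a) - a(b + c), and Omega_B
   and Omega_C to the cyclic shifts of this expression. The values are 0, 1, 1 at
   (a, b, c) = (0, 1, -1), and 1, 0, 1 at (-1, 0, 1). *)
theory Submission
  imports Defs
begin

text \<open>This is the algebra homomorphism from the free algebra to the field given by the
  universal property.\<close>

definition free_eval :: "(generator \<Rightarrow> 'f) \<Rightarrow> 'f free_alg \<Rightarrow> 'f::field" where
  "free_eval v p = (\<Sum>w. Poly_Mapping.lookup p w * prod_list (map v (letters w)))"

text \<open>Additivity of the unrestricted sum over words requires finite support.\<close>

lemma finite_free_eval_support:
  "finite {w. Poly_Mapping.lookup p w * prod_list (map v (letters w)) \<noteq> (0 :: 'f::field)}"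
  by (rule finite_subset[OF _ finite_lookup[of p]]) auto

lemma free_eval_add: "free_eval v (p + q) = free_eval v p + free_eval v q"
  unfolding free_eval_def lookup_add distrib_right
  by (rule Sum_any.distrib) (rule finite_free_eval_support)+

lemma free_eval_single:
  "free_eval v (Poly_Mapping.single w c) = c * prod_list (map v (letters w))"
proof -
  have "free_eval v (Poly_Mapping.single w c)
      = (\<Sum>u. c * prod_list (map v (letters u)) when u = w)"
    unfolding free_eval_def by (rule Sum_any.cong) (auto simp: lookup_single when_def)
  then show ?thesis by simp
qed

lemma free_eval_0: "free_eval v 0 = 0"
  by (simp add: free_eval_def)

lemma update_eq_add_single:
  "a \<notin> Poly_Mapping.keys p \<Longrightarrow> Poly_Mapping.update a b p = p + Poly_Mapping.single a b"
  for p :: "'f::field free_alg"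
  by (intro poly_mapping_eqI)
    (auto simp: lookup_update lookup_add lookup_single when_def in_keys_iff)

text \<open>Both sides are additive in each factor, so two nested inductions reduce the claim to
  single words, where concatenation multiplies the values.\<close>

lemma free_eval_mult: "free_eval v (p * q) = free_eval v p * free_eval v q"
proof (induction p rule: Poly_Mapping.update_induct)
  case const
  then show ?case by (simp add: free_eval_0)
next
  case (update p w c)
  have "free_eval v (Poly_Mapping.single w c * q)
      = free_eval v (Poly_Mapping.single w c) * free_eval v q"
  proof (induction q rule: Poly_Mapping.update_induct)
    case const
    then show ?case by (simp add: free_eval_0)
  next
    case (update q u d)
    then show ?case
      by (simp add: update_eq_add_single distrib_left free_eval_add mult_single free_eval_single
          plus_gword_def)
  qed
  with update show ?case
    by (simp add: update_eq_add_single distrib_right free_eval_add)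
qed

lemma free_eval_uminus: "free_eval v (- p) = - free_eval v p"
  by (metis add.right_inverse eq_neg_iff_add_eq_0 free_eval_0 free_eval_add add.commute)

lemma free_eval_diff: "free_eval v (p - q) = free_eval v p - free_eval v q"
  by (metis diff_conv_add_uminus free_eval_add free_eval_uminus)

lemma free_eval_gen: "free_eval v (free_gen g) = v g"
  by (simp add: free_gen_def free_eval_single)

text \<open>The target field is commutative. This disposes of all centrality relators at
  once.\<close>

lemma free_eval_commutator: "free_eval v (commutator p q) = 0"
  by (simp add: commutator_def free_eval_diff free_eval_mult)

text \<open>The centrality relators are commutators, and each of the other three relators evaluates
  to \<open>- 2 * v Gen_D\<close>.\<close>

lemma free_eval_ideal:
  assumes "v Gen_D = 0" "p \<in> two_sided_ideal racah_relators"
  shows "free_eval v p = 0"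
  using assms(2)
proof (induction rule: two_sided_ideal.induct)
  case (gen s a b)
  then have "free_eval v s = 0"
    using assms(1)
    by (auto simp: racah_relators_def Let_def free_eval_commutator free_eval_diff free_eval_mult
        free_eval_gen)
  then show ?case by (simp add: free_eval_mult)
qed (simp_all add: free_eval_add free_eval_0)

lift_definition racah_char :: "'f \<Rightarrow> 'f \<Rightarrow> 'f \<Rightarrow> 'f::field racah \<Rightarrow> 'f"
  is "\<lambda>a b c. free_eval (case_generator a b c 0)"
  by (metis racah_rel_def free_eval_ideal free_eval_diff eq_iff_diff_eq_0 generator.case(4))

lemma racah_char_hom:
  "racah_char a b c (x + y) = racah_char a b c x + racah_char a b c y"
  "racah_char a b c (x - y) = racah_char a b c x - racah_char a b c y"
  "racah_char a b c (x * y) = racah_char a b c x * racah_char a b c y"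
  "racah_char a b c (r *\<^sub>F x) = r * racah_char a b c x"
  by (transfer; simp add: free_eval_add free_eval_diff free_eval_mult free_eval_single
      zero_gword_def)+

lemma racah_char_gen:
  "racah_char a b c racah_A = a"
  "racah_char a b c racah_B = b"
  "racah_char a b c racah_C = c"
  "racah_char a b c racah_D = 0"
  by (transfer; simp add: free_eval_gen)+

text \<open>The central elements map to a(c - b), b(a - c) and c(b - a). Since 2 is invertible, half
  the sum of the two cubic words becomes abc, and the square in each Casimir element cancels against
  part of the \<open>racah_delta\<close> term.\<close>

lemma racah_char_Omega:
  assumes "(2 :: 'f::field) \<noteq> 0"
  shows "racah_char a b c (Omega_A :: 'f racah) = b * c * (b + c - a) - a * (b + c)"
    and "racah_char a b c (Omega_B :: 'f racah) = c * a * (c + a - b) - b * (c + a)"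
    and "racah_char a b c (Omega_C :: 'f racah) = a * b * (a + b - c) - c * (a + b)"
  using assms
  by (simp_all add: Omega_A_def Omega_B_def Omega_C_def racah_alpha_def racah_beta_def
      racah_gamma_def racah_delta_def alpha_expr_def beta_expr_def gamma_expr_def commutator_def
      power2_eq_square racah_char_hom racah_char_gen field_simps)

theorem corollary6p5:
  assumes "CHAR('f::field) \<noteq> 2"
  shows "(Omega_A :: 'f racah) \<noteq> Omega_B \<and>
         (Omega_B :: 'f racah) \<noteq> Omega_C \<and>
         (Omega_A :: 'f racah) \<noteq> Omega_C"
proof -
  \<comment> \<open>The only divisors of 2 are 1 and 2, and a field never has characteristic
    1.\<close>
  have "\<not> CHAR('f) dvd 2"
  proof
    assume "CHAR('f) dvd 2"
    moreover from this have "CHAR('f) \<le> 2"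
      by (rule dvd_imp_le) simp
    ultimately show False
      using assms CHAR_not_1[where ?'a = 'f] by (auto simp: le_Suc_eq numeral_2_eq_2)
  qed
  then have "(2 :: 'f) \<noteq> 0"
    using of_nat_eq_0_iff_char_dvd[of 2, where ?'a = 'f] by simp
  note Omega = racah_char_Omega[OF this]
  \<comment> \<open>Both points have a zero coordinate and coordinate sum zero, so every cubic term
    vanishes. The first separates \<open>Omega_A\<close> from the other two, and its cyclic shift
    separates \<open>Omega_B\<close> from \<open>Omega_C\<close>. The values 0 and 1 differ in every
    field.\<close>
  have "racah_char 0 1 (-1) (Omega_A :: 'f racah) = 0"
    "racah_char 0 1 (-1) (Omega_B :: 'f racah) = 1"
    "racah_char 0 1 (-1) (Omega_C :: 'f racah) = 1"
    "racah_char (-1) 0 1 (Omega_B :: 'f racah) = 0"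
    "racah_char (-1) 0 1 (Omega_C :: 'f racah) = 1"
    by (simp_all add: Omega)
  then show ?thesis
    by (metis zero_neq_one)
qed

end
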